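(* Let $t \in (0,1/2)$ and let $f_t(x) = 2^{2t-1} x^t (1+x)^{1-2t}$ for $x>0$. Then $f_t(x) \ge \sqrt{x}$ for all $x>0$. Moreover, for every $n \ge 1$ and all strictly positive numbers $\lambda_1,\dots,\lambda_n$, the matrix $T \in \mathbf{M}_n$ with entries $$T_{ij} = \frac{1}{m_{f_t}(\lambda_i,\lambda_j)} = \frac{2^{1-2t}}{(\lambda_i+\lambda_j)^{1-2t}}(\lambda_i\lambda_j)^{-t}$$ is positive, and the corresponding mapping $\beta:\mathbf{M}_n\to\mathbf{M}_n$, $\beta(A) = A\circ T$, is completely positive.
   Context: $\mathbf{M}_n$ is the algebra of $n\times n$ complex matrices; a matrix is called positive if it is positive semidefinite. $A\circ T$ denotes the Hadamard (entrywise) product. For a function $f:\mathbb{R}^+\to\mathbb{R}^+$ (where $\mathbb{R}^+=(0,\infty)$), $m_f(x,y) = x f(y/x)$ for $x,y>0$. *)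

theory Defs
  imports "Jordan_Normal_Form.Schur_Decomposition" Complex_Main
begin

text \<open>\<open>\<bullet>c\<close> conjugates its second argument, so the quadratic form below is \<open>v\<^sup>* A v\<close>.
  The equation \<open>mat_adjoint A = A\<close> also forces \<open>A\<close> to be square.\<close>

definition positive_mat :: "complex mat \<Rightarrow> bool" where
  "positive_mat A \<longleftrightarrow>
     mat_adjoint A = A \<and> (\<forall>v \<in> carrier_vec (dim_row A). 0 \<le> Re ((A *\<^sub>v v) \<bullet>c v))"

text \<open>Meant for two matrices of the same dimensions; the result takes those of the first.\<close>

definition hadamard :: "complex mat \<Rightarrow> complex mat \<Rightarrow> complex mat" where
  "hadamard A B = mat (dim_row A) (dim_col A) (\<lambda>(i, j). A $$ (i, j) * B $$ (i, j))"

text \<open>A \<open>k \<times> k\<close> block matrix with \<open>n \<times> n\<close> blocks is a \<open>(k * n) \<times> (k * n)\<close> matrix; the entry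
  \<open>(p, q)\<close> of its block \<open>(a, b)\<close> has the indices \<open>(a * n + p, b * n + q)\<close>.\<close>

definition mat_block :: "nat \<Rightarrow> complex mat \<Rightarrow> nat \<Rightarrow> nat \<Rightarrow> complex mat" where
  "mat_block n X a b = mat n n (\<lambda>(p, q). X $$ (a * n + p, b * n + q))"

text \<open>The map \<open>id\<^sub>k \<otimes> \<Phi>\<close>, applying \<open>\<Phi>\<close> to every block.\<close>

definition ampliation ::
    "nat \<Rightarrow> nat \<Rightarrow> (complex mat \<Rightarrow> complex mat) \<Rightarrow> complex mat \<Rightarrow> complex mat" where
  "ampliation k n \<Phi> X =
     mat (k * n) (k * n)
       (\<lambda>(r, s). \<Phi> (mat_block n X (r div n) (s div n)) $$ (r mod n, s mod n))"

definition linear_mat_map :: "nat \<Rightarrow> (complex mat \<Rightarrow> complex mat) \<Rightarrow> bool" where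
  "linear_mat_map n \<Phi> \<longleftrightarrow>
     (\<forall>A \<in> carrier_mat n n. \<Phi> A \<in> carrier_mat n n) \<and>
     (\<forall>A \<in> carrier_mat n n. \<forall>B \<in> carrier_mat n n. \<Phi> (A + B) = \<Phi> A + \<Phi> B) \<and>
     (\<forall>c. \<forall>A \<in> carrier_mat n n. \<Phi> (c \<cdot>\<^sub>m A) = c \<cdot>\<^sub>m \<Phi> A)"

definition completely_positive :: "nat \<Rightarrow> (complex mat \<Rightarrow> complex mat) \<Rightarrow> bool" where
  "completely_positive n \<Phi> \<longleftrightarrow>
     linear_mat_map n \<Phi> \<and>
     (\<forall>k \<ge> 1. \<forall>X \<in> carrier_mat (k * n) (k * n).
        positive_mat X \<longrightarrow> positive_mat (ampliation k n \<Phi> X))"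

definition mean_of :: "(real \<Rightarrow> real) \<Rightarrow> real \<Rightarrow> real \<Rightarrow> real" where
  "mean_of f x y = x * f (y / x)"

definition f_fun :: "real \<Rightarrow> real \<Rightarrow> real" where
  "f_fun t x = 2 powr (2 * t - 1) * x powr t * (1 + x) powr (1 - 2 * t)"

definition T_mat :: "real \<Rightarrow> nat \<Rightarrow> (nat \<Rightarrow> real) \<Rightarrow> complex mat" where
  "T_mat t n l = mat n n (\<lambda>(i, j). complex_of_real (1 / mean_of (f_fun t) (l i) (l j)))"

end

theory Submission
  imports "HOL-Analysis.Generalised_Binomial_Theorem" Defs
begin

text \<open>Write \<open>s = 1 - 2 * t\<close>, so that \<open>0 < s\<close>. Since \<open>f_fun t x\<close> is
  \<open>x powr t * ((1 + x) / 2) powr s\<close>, the bound by \<open>sqrt x\<close> is the inequality of the arithmetic and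
  geometric means of \<open>1\<close> and \<open>x\<close>, raised to the power \<open>s\<close>.

  For positivity the point is that \<open>(x + y) powr (- s)\<close> is a positive kernel on the positive reals.
  The Cayley transform \<open>cayley x = (1 - x) / (1 + x)\<close> maps the positive reals into \<open>{-1<..<1}\<close> and
  turns the sum into a product:
  \<open>x + y = (1 + x) * (1 + y) / 2 * (1 - cayley x * cayley y)\<close>. The binomial series of
  \<open>(1 - z) powr (- s)\<close> has the nonnegative coefficients \<open>pochhammer s k / fact k\<close>, so expanding at
  \<open>z = cayley x * cayley y\<close> writes the kernel, and with it the matrix \<open>T\<close>, as a convergent series of
  real matrices of rank one (\<open>inverse_mean_of_f_fun_sums\<close>).

  Multiplying a positive matrix entrywise by such a series keeps it positive
  (\<open>positive_mat_hadamard_rank_one_series\<close>): each rank-one factor only rescales the vector in the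
  quadratic form. Both remaining claims are instances. The matrix \<open>T\<close> is the Hadamard product of the
  all-ones matrix with \<open>T\<close>, and the ampliation of Hadamard multiplication by \<open>T\<close> is Hadamard
  multiplication by the block matrix all of whose blocks are \<open>T\<close>, which has a rank-one series
  because \<open>T\<close> has one.\<close>

unbundle no vec_syntax

section \<open>Schur multiplication by series of rank-one matrices\<close>

lemma cscalar_prod_mult_mat_vec:
  fixes A :: "complex mat"
  assumes "A \<in> carrier_mat m m" and "v \<in> carrier_vec m"
  shows "(A *\<^sub>v v) \<bullet>c v = (\<Sum>i<m. \<Sum>j<m. A $$ (i, j) * v $ j * cnj (v $ i))"
  using assms
  by (auto simp: scalar_prod_def sum_distrib_right lessThan_atLeast0 intro!: sum.cong)

lemma mat_adjoint_eq_self_iff: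
  fixes A :: "complex mat"
  assumes "A \<in> carrier_mat m m"
  shows "mat_adjoint A = A \<longleftrightarrow> (\<forall>i<m. \<forall>j<m. cnj (A $$ (j, i)) = A $$ (i, j))"
proof -
  have "mat_adjoint A = mat m m (\<lambda>(i, j). cnj (A $$ (j, i)))"
    using assms by (intro eq_matI) (auto simp: mat_adjoint_def mat_of_rows_def)
  then show ?thesis
    using assms by (simp add: mat_eq_iff)
qed

lemma positive_mat_iff:
  assumes "A \<in> carrier_mat m m"
  shows "positive_mat A \<longleftrightarrow>
    (\<forall>i<m. \<forall>j<m. cnj (A $$ (j, i)) = A $$ (i, j)) \<and>
    (\<forall>v \<in> carrier_vec m. 0 \<le> Re (\<Sum>i<m. \<Sum>j<m. A $$ (i, j) * v $ j * cnj (v $ i)))"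
  using assms mat_adjoint_eq_self_iff[OF assms] cscalar_prod_mult_mat_vec[OF assms]
  by (auto simp: positive_mat_def)

text \<open>The rank-one matrix with entries \<open>g k i * g k j\<close> acts on the quadratic form of \<open>A\<close> by replacing
  the vector \<open>v\<close> with its rescaling by \<open>g k\<close>. So the form of the Hadamard product is a convergent sum
  of values of the form of \<open>A\<close>, each of them nonnegative.\<close>

lemma positive_mat_hadamard_rank_one_series:
  fixes g :: "nat \<Rightarrow> nat \<Rightarrow> real"
  assumes A: "A \<in> carrier_mat m m" and pos: "positive_mat A"
    and S: "\<And>i j. i < m \<Longrightarrow> j < m \<Longrightarrow> S $$ (i, j) = complex_of_real (\<sigma> i j)"
    and sums: "\<And>i j. i < m \<Longrightarrow> j < m \<Longrightarrow> (\<lambda>k. g k i * g k j) sums \<sigma> i j"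
  shows "positive_mat (hadamard A S)"
proof -
  have H: "hadamard A S \<in> carrier_mat m m"
    using A by (auto simp: hadamard_def)
  have entry: "hadamard A S $$ (i, j) = A $$ (i, j) * complex_of_real (\<sigma> i j)"
    if "i < m" "j < m" for i j
    using A S that by (auto simp: hadamard_def)
  have sym: "\<sigma> i j = \<sigma> j i" if "i < m" "j < m" for i j
    using sums_unique2[OF sums[OF that]] sums[OF that(2,1)] by (simp add: mult.commute)
  have herm: "cnj (A $$ (j, i)) = A $$ (i, j)" if "i < m" "j < m" for i j
    using pos that positive_mat_iff[OF A] by blast
  have "0 \<le> Re (\<Sum>i<m. \<Sum>j<m. hadamard A S $$ (i, j) * v $ j * cnj (v $ i))"
    if v: "v \<in> carrier_vec m" for v
  proof -
    \<comment> \<open>both occurrences of \<open>v\<close> in the form are rescaled alike, as \<open>g\<close> is real\<close>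
    define w where "w k = vec m (\<lambda>i. complex_of_real (g k i) * v $ i)" for k
    have "(\<lambda>k. \<Sum>i<m. \<Sum>j<m. A $$ (i, j) * w k $ j * cnj (w k $ i)) sums
        (\<Sum>i<m. \<Sum>j<m. hadamard A S $$ (i, j) * v $ j * cnj (v $ i))"
    proof (intro sums_sum)
      fix i j assume ij: "i \<in> {..<m}" "j \<in> {..<m}"
      then have "(\<lambda>k. complex_of_real (g k i * g k j)) sums complex_of_real (\<sigma> i j)"
        by (intro sums_of_real sums) auto
      from sums_mult[OF this, of "A $$ (i, j) * v $ j * cnj (v $ i)"]
      show "(\<lambda>k. A $$ (i, j) * w k $ j * cnj (w k $ i)) sums
          (hadamard A S $$ (i, j) * v $ j * cnj (v $ i))"
        using ij entry by (simp add: w_def mult_ac)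
    qed
    then have "(\<lambda>k. Re (\<Sum>i<m. \<Sum>j<m. A $$ (i, j) * w k $ j * cnj (w k $ i))) sums
        Re (\<Sum>i<m. \<Sum>j<m. hadamard A S $$ (i, j) * v $ j * cnj (v $ i))"
      by (rule sums_Re)
    moreover have "0 \<le> Re (\<Sum>i<m. \<Sum>j<m. A $$ (i, j) * w k $ j * cnj (w k $ i))" for k
    proof -
      have "w k \<in> carrier_vec m"
        by (simp add: w_def)
      then show ?thesis
        using pos positive_mat_iff[OF A] by blast
    qed
    ultimately show ?thesis
      by (rule sums_le[OF _ sums_zero, rotated])
  qed
  moreover have "cnj (hadamard A S $$ (j, i)) = hadamard A S $$ (i, j)" if "i < m" "j < m" for i j
    by (simp add: entry that herm[OF that] sym[OF that])
  ultimately show ?thesis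
    unfolding positive_mat_iff[OF H] by blast
qed

lemma positive_mat_all_ones: "positive_mat (mat n n (\<lambda>_. 1))"
proof -
  have "0 \<le> Re (cnj z * z)" for z
    by simp
  moreover have "(\<Sum>i<n. \<Sum>j<n. mat n n (\<lambda>_. 1) $$ (i, j) * v $ j * cnj (v $ i)) =
      cnj (\<Sum>i<n. v $ i) * (\<Sum>j<n. v $ j)" for v :: "complex vec"
    by (simp add: sum_product mult.commute[of "cnj _"])
  ultimately show ?thesis
    by (subst positive_mat_iff[where m = n]) (simp_all only: mat_carrier, simp)
qed

lemma linear_mat_map_hadamard: "linear_mat_map n (\<lambda>A. hadamard A S)"
  by (auto simp: linear_mat_map_def hadamard_def algebra_simps)

text \<open>Applying a Schur multiplier to every block is again a Schur multiplier: its matrix repeats \<open>S\<close>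
  in every block, so its indices are those of \<open>S\<close> taken modulo \<open>n\<close>.\<close>

lemma ampliation_hadamard:
  assumes "n \<ge> 1" and "X \<in> carrier_mat (k * n) (k * n)"
  shows "ampliation k n (\<lambda>A. hadamard A S) X =
    hadamard X (mat (k * n) (k * n) (\<lambda>(r, s). S $$ (r mod n, s mod n)))"
  using assms by (intro eq_matI) (auto simp: ampliation_def hadamard_def mat_block_def)

lemma
  fixes g :: "nat \<Rightarrow> nat \<Rightarrow> real"
  assumes n: "n \<ge> 1"
    and S: "\<And>i j. i < n \<Longrightarrow> j < n \<Longrightarrow> S $$ (i, j) = complex_of_real (\<sigma> i j)"
    and sums: "\<And>i j. i < n \<Longrightarrow> j < n \<Longrightarrow> (\<lambda>k. g k i * g k j) sums \<sigma> i j"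
  shows positive_mat_rank_one_series: "S \<in> carrier_mat n n \<Longrightarrow> positive_mat S"
    and completely_positive_rank_one_series: "completely_positive n (\<lambda>A. hadamard A S)"
proof -
  show "positive_mat S" if "S \<in> carrier_mat n n"
  proof -
    have "hadamard (mat n n (\<lambda>_. 1)) S = S"
      using that by (intro eq_matI) (auto simp: hadamard_def)
    moreover have "positive_mat (hadamard (mat n n (\<lambda>_. 1)) S)"
      by (rule positive_mat_hadamard_rank_one_series[OF _ positive_mat_all_ones S sums]) auto
    ultimately show ?thesis
      by simp
  qed
  show "completely_positive n (\<lambda>A. hadamard A S)"
    unfolding completely_positive_def
  proof (intro conjI allI impI ballI)
    fix k X
    assume X: "X \<in> carrier_mat (k * n) (k * n)" "positive_mat X"
    show "positive_mat (ampliation k n (\<lambda>A. hadamard A S) X)"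
      unfolding ampliation_hadamard[OF n X(1)]
      by (rule positive_mat_hadamard_rank_one_series[OF X,
            where g = "\<lambda>k r. g k (r mod n)" and \<sigma> = "\<lambda>r s. \<sigma> (r mod n) (s mod n)"])
         (use n in \<open>auto intro!: S sums\<close>)
  qed (rule linear_mat_map_hadamard)
qed

section \<open>The kernel of a negative power of a sum\<close>

text \<open>In the binomial series of exponent \<open>- s\<close> at \<open>- z\<close>, the sign \<open>(- 1) ^ k\<close> of the coefficient
  cancels that of \<open>(- z) ^ k\<close>. What remains is nonnegative for \<open>s \<ge> 0\<close>.\<close>

lemma one_minus_powr_neg_sums:
  fixes s z :: real
  assumes "\<bar>z\<bar> < 1"
  shows "(\<lambda>k. pochhammer s k / fact k * z ^ k) sums (1 - z) powr (- s)"
proof -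
  have "((- s) gchoose k) * (- z) ^ k = pochhammer s k / fact k * z ^ k" for k
  proof -
    have "(- 1) ^ k * (- z) ^ k = z ^ k"
      by (subst power_mult_distrib[symmetric]) simp
    moreover have "((- s) gchoose k) * (- z) ^ k =
        pochhammer s k / fact k * ((- 1) ^ k * (- z) ^ k)"
      by (simp only: gbinomial_pochhammer minus_minus times_divide_eq_left
          times_divide_eq_right mult_ac)
    ultimately show ?thesis
      by simp
  qed
  then show ?thesis
    using gen_binomial_real[of "- z" "- s"] assms by simp
qed

definition cayley :: "real \<Rightarrow> real" where
  "cayley x = (1 - x) / (1 + x)"

lemma abs_cayley_less_1: "x > 0 \<Longrightarrow> \<bar>cayley x\<bar> < 1"
  by (auto simp: cayley_def abs_less_iff field_simps)

lemma add_eq_cayley: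
  assumes "x > 0" and "y > 0"
  shows "x + y = (1 + x) * (1 + y) / 2 * (1 - cayley x * cayley y)"
  using assms by (simp add: cayley_def divide_simps) (simp add: algebra_simps)

text \<open>Raising the factorization of \<open>x + y\<close> to the power \<open>- s\<close> leaves a factor that separates into
  \<open>x\<close> and \<open>y\<close>, times a binomial series in \<open>cayley x * cayley y\<close>, whose terms separate as well. The
  coefficients have real square roots, so each term is a product of the same function at \<open>x\<close> and at
  \<open>y\<close>; that symmetry is what makes the kernel positive.\<close>

lemma powr_neg_add_sums:
  fixes s x y :: real
  assumes s: "s \<ge> 0" and x: "x > 0" and y: "y > 0"
  defines "h \<equiv> \<lambda>k x. sqrt (2 powr s * (pochhammer s k / fact k)) * (1 + x) powr (- s) * cayley x ^ k"
  shows "(\<lambda>k. h k x * h k y) sums (x + y) powr (- s)"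
proof -
  have z: "\<bar>cayley x * cayley y\<bar> < 1"
    using abs_cayley_less_1[OF x] abs_cayley_less_1[OF y]
      mult_strict_mono'[of "\<bar>cayley x\<bar>" 1 "\<bar>cayley y\<bar>" 1]
    by (simp add: abs_mult)
  define c where "c = 2 powr s * (1 + x) powr (- s) * (1 + y) powr (- s)"
  have "(x + y) powr (- s) = c * (1 - cayley x * cayley y) powr (- s)"
    using x y z
    by (subst add_eq_cayley[OF x y]) (simp add: c_def powr_mult powr_divide powr_minus_divide)
  moreover have "h k x * h k y = c * (pochhammer s k / fact k * (cayley x * cayley y) ^ k)" for k
  proof -
    define d where "d = pochhammer s k / fact k"
    have "0 \<le> d"
      using s by (cases "s = 0") (auto simp: d_def pochhammer_0_left pochhammer_nonneg)
    then have root: "sqrt (2 powr s * d) * sqrt (2 powr s * d) = 2 powr s * d"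
      by simp
    have "h k x * h k y = (sqrt (2 powr s * d) * sqrt (2 powr s * d)) *
        ((1 + x) powr (- s) * (1 + y) powr (- s) * (cayley x * cayley y) ^ k)"
      by (simp only: h_def power_mult_distrib mult_ac flip: d_def)
    then show ?thesis
      unfolding root by (simp only: c_def mult_ac flip: d_def)
  qed
  ultimately show ?thesis
    using sums_mult[OF one_minus_powr_neg_sums[OF z, of s], of c] by simp
qed

section \<open>The means of the functions f and their matrices\<close>

lemma sqrt_le_f_fun:
  assumes "t \<le> 1 / 2" and "x > 0"
  shows "sqrt x \<le> f_fun t x"
proof -
  have amgm: "sqrt x \<le> (1 + x) / 2"
    using arith_geo_mean_sqrt[of 1 x] assms by simp
  have "sqrt x = x powr t * sqrt x powr (1 - 2 * t)"
  proof -
    have "x powr t * sqrt x powr (1 - 2 * t) = x powr (t + 1 / 2 * (1 - 2 * t))"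
      using assms by (simp only: powr_add powr_powr flip: powr_half_sqrt[OF less_imp_le])
    also have "t + 1 / 2 * (1 - 2 * t) = 1 / 2"
      by (simp only: right_diff_distrib)
    finally show ?thesis
      using assms by (simp add: powr_half_sqrt)
  qed
  also have "\<dots> \<le> x powr t * ((1 + x) / 2) powr (1 - 2 * t)"
    using assms amgm by (intro mult_left_mono powr_mono2) auto
  also have "\<dots> = f_fun t x"
    using assms by (simp add: f_fun_def powr_divide powr_diff field_simps)
  finally show ?thesis .
qed

lemma mean_of_f_fun:
  assumes "x > 0" and "y > 0"
  shows "mean_of (f_fun t) x y = 2 powr (2 * t - 1) * (x + y) powr (1 - 2 * t) * (x * y) powr t"
proof -
  have "1 + y / x = (x + y) / x"
    using assms by (simp add: field_simps)
  moreover have "x = x powr t * x powr t * x powr (1 - 2 * t)"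
    using assms by (simp flip: powr_add)
  ultimately show ?thesis
    using assms unfolding mean_of_def f_fun_def
    by (simp add: powr_mult powr_divide) (simp add: field_simps)
qed

lemma inverse_mean_of_f_fun:
  assumes "x > 0" and "y > 0"
  shows "1 / mean_of (f_fun t) x y =
    2 powr (1 - 2 * t) / (x + y) powr (1 - 2 * t) * (x * y) powr (- t)"
proof -
  have "2 powr (1 - 2 * t) = 1 / (2 powr (2 * t - 1) :: real)"
    using powr_minus_divide[of 2 "2 * t - 1"] by simp
  then show ?thesis
    by (simp add: mean_of_f_fun[OF assms] powr_minus_divide)
qed

text \<open>Multiplying the kernel \<open>(x + y) powr (- (1 - 2 * t))\<close> by the rank-one factor
  \<open>(x * y) powr (- t)\<close> only rescales the functions in its expansion. These do not depend on
  the points, so one family \<open>h\<close> serves all entries of all the matrices.\<close>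

lemma inverse_mean_of_f_fun_sums:
  assumes "t \<le> 1 / 2"
  obtains h :: "nat \<Rightarrow> real \<Rightarrow> real"
  where "\<And>x y. x > 0 \<Longrightarrow> y > 0 \<Longrightarrow> (\<lambda>k. h k x * h k y) sums (1 / mean_of (f_fun t) x y)"
proof -
  define s where "s = 1 - 2 * t"
  have s: "s \<ge> 0"
    using assms by (simp add: s_def)
  define h where "h k x =
      sqrt (2 powr s * (pochhammer s k / fact k)) * (1 + x) powr (- s) * cayley x ^ k" for k x
  define h' where "h' k x = sqrt (2 powr s) * x powr (- t) * h k x" for k x
  have "(\<lambda>k. h' k x * h' k y) sums (1 / mean_of (f_fun t) x y)" if xy: "x > 0" "y > 0" for x y
  proof -
    have "h' k x * h' k y = 2 powr s * (x * y) powr (- t) * (h k x * h k y)" for k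
      using xy by (simp add: h'_def powr_mult)
    moreover have "1 / mean_of (f_fun t) x y = 2 powr s * (x * y) powr (- t) * (x + y) powr (- s)"
      by (simp add: inverse_mean_of_f_fun[OF xy] powr_minus_divide flip: s_def)
    ultimately show ?thesis
      using sums_mult[OF powr_neg_add_sums[OF s xy], of "2 powr s * (x * y) powr (- t)"]
      by (simp add: h_def)
  qed
  then show ?thesis
    using that by blast
qed

theorem theorem1:
  fixes t :: real
  assumes "0 < t" and "t < 1 / 2"
  shows "(\<forall>x>0. f_fun t x \<ge> sqrt x) \<and>
    (\<forall>n\<ge>1. \<forall>l :: nat \<Rightarrow> real. (\<forall>i<n. 0 < l i) \<longrightarrow>
      (\<forall>i<n. \<forall>j<n. T_mat t n l $$ (i, j) =
         complex_of_real
           (2 powr (1 - 2 * t) / (l i + l j) powr (1 - 2 * t) * (l i * l j) powr (- t))) \<and>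
      positive_mat (T_mat t n l) \<and>
      completely_positive n (\<lambda>A. hadamard A (T_mat t n l)))"
proof (intro conjI allI impI)
  show "sqrt x \<le> f_fun t x" if "x > 0" for x
    using sqrt_le_f_fun that assms by simp
next
  fix n :: nat and l :: "nat \<Rightarrow> real"
  assume n: "n \<ge> 1" and l: "\<forall>i<n. 0 < l i"
  have carrier: "T_mat t n l \<in> carrier_mat n n"
    by (simp add: T_mat_def)
  have entry: "T_mat t n l $$ (i, j) = complex_of_real (1 / mean_of (f_fun t) (l i) (l j))"
    if "i < n" "j < n" for i j
    using that by (simp add: T_mat_def)
  show "T_mat t n l $$ (i, j) = complex_of_real
      (2 powr (1 - 2 * t) / (l i + l j) powr (1 - 2 * t) * (l i * l j) powr (- t))"
    if "i < n" "j < n" for i j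
    using that l by (simp only: entry inverse_mean_of_f_fun)
  obtain h :: "nat \<Rightarrow> real \<Rightarrow> real" where
    h: "\<And>x y. x > 0 \<Longrightarrow> y > 0 \<Longrightarrow> (\<lambda>k. h k x * h k y) sums (1 / mean_of (f_fun t) x y)"
    using inverse_mean_of_f_fun_sums assms by (meson less_imp_le)
  have sums: "(\<lambda>k. h k (l i) * h k (l j)) sums (1 / mean_of (f_fun t) (l i) (l j))"
    if "i < n" "j < n" for i j
    using h l that by blast
  show "positive_mat (T_mat t n l)"
    using positive_mat_rank_one_series[OF n entry sums carrier] .
  show "completely_positive n (\<lambda>A. hadamard A (T_mat t n l))"
    using completely_positive_rank_one_series[OF n entry sums] .
qed

end
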